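(* Let $\mathcal H^g$ be the Hopf algebra of graphs considered up to isomorphism and 1-sums, and let $\alpha(x_1,x_2,y_1,y_2)=\exp_*(x_1\delta_b+x_2\delta_l)*\exp_*(y_1\delta_b+y_2\delta_l)$. Then for every graph $G$, $$\alpha(x_1,x_2,y_1,y_2)(G)=x_1^{r(G)}\,y_2^{|E(G)|-r(G)}\,T_G\Big(\frac{y_1}{x_1}+1,\frac{x_2}{y_2}+1\Big).$$
   Context: Graphs are finite, loops and multiple edges allowed. A 1-sum $G\oplus_1H$ is obtained from disjoint graphs by identifying a vertex of $G$ with a vertex of $H$. $\mathcal H^g$ is the free module (over a field of characteristic 0) spanned by equivalence classes of graphs under isomorphism and the relation identifying $G\oplus_1 H$ with the disjoint union $G\sqcup H$ (so all edgeless graphs are equivalent); it is graded by number of edges, multiplication is disjoint union, counit is $1$ on edgeless classes and $0$ otherwise, and the coproduct is $\Delta(G)=\sum_{A\subseteq E(G)}G\backslash A^c\otimes G/A$ with usual graph deletion and contraction. $\delta_b$ is the linear map equal to $1$ on the class of the graph with two vertices joined by one edge and $0$ on all other classes; $\delta_l$ is $1$ on the class of the one-vertex graph with one loop and $0$ otherwise. $f*g=m\circ(f\otimes g)\circ\Delta$, $\exp_*(\delta)=\sum_{k\ge0}\delta^{*k}/k!$ with $\delta^{*0}=\varepsilon$. For $A\subseteq E(G)$, $r(A)=|V(G)|-c(A)$ where $c(A)$ is the number of components of the spanning subgraph $(V(G),A)$; $r(G)=r(E(G))$; $T_G(x,y)=\sum_{A\subseteq E(G)}(x-1)^{r(G)-r(A)}(y-1)^{|A|-r(A)}$.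 *)

theory Defs
  imports Main "HOL-Library.Poly_Mapping"
begin

section \<open>Finite multigraphs\<close>

text \<open>
  Loops and parallel edges are allowed: \<^term>\<open>ends G e\<close> is the set of end vertices of the
  edge \<^term>\<open>e\<close>, a singleton exactly when \<^term>\<open>e\<close> is a loop.
\<close>

record ('v, 'e) mgraph =
  verts :: "'v set"
  edges :: "'e set"
  ends  :: "'e \<Rightarrow> 'v set"

definition is_graph :: "('v, 'e) mgraph \<Rightarrow> bool" where
  "is_graph G \<longleftrightarrow> finite (verts G) \<and> finite (edges G) \<and>
     (\<forall>e\<in>edges G. ends G e \<subseteq> verts G \<and> card (ends G e) \<in> {1, 2})"

definition graph_iso :: "('v, 'e) mgraph \<Rightarrow> ('w, 'f) mgraph \<Rightarrow> bool" where
  "graph_iso G H \<longleftrightarrow> (\<exists>\<phi> \<psi>. bij_betw \<phi> (verts G) (verts H) \<and> bij_betw \<psi> (edges G) (edges H) \<and>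
     (\<forall>e\<in>edges G. ends H (\<psi> e) = \<phi> ` ends G e))"

definition disj_union :: "('v, 'e) mgraph \<Rightarrow> ('w, 'f) mgraph \<Rightarrow> ('v + 'w, 'e + 'f) mgraph" where
  "disj_union G H =
     \<lparr>verts = Inl ` verts G \<union> Inr ` verts H,
      edges = Inl ` edges G \<union> Inr ` edges H,
      ends = case_sum (\<lambda>e. Inl ` ends G e) (\<lambda>f. Inr ` ends H f)\<rparr>"

text \<open>The vertex \<^term>\<open>w\<close> of \<^term>\<open>H\<close> is identified with the vertex \<^term>\<open>v\<close> of \<^term>\<open>G\<close>.\<close>

definition one_sum ::
    "('v, 'e) mgraph \<Rightarrow> 'v \<Rightarrow> ('w, 'f) mgraph \<Rightarrow> 'w \<Rightarrow> ('v + 'w, 'e + 'f) mgraph" where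
  "one_sum G v H w =
     \<lparr>verts = Inl ` verts G \<union> Inr ` (verts H - {w}),
      edges = Inl ` edges G \<union> Inr ` edges H,
      ends = case_sum (\<lambda>e. Inl ` ends G e)
                      (\<lambda>f. (\<lambda>u. if u = w then Inl v else Inr u) ` ends H f)\<rparr>"

definition reach :: "('v, 'e) mgraph \<Rightarrow> 'e set \<Rightarrow> 'v rel" where
  "reach G A = {(u, v). \<exists>e\<in>A. ends G e = {u, v}}\<^sup>*"

definition components :: "('v, 'e) mgraph \<Rightarrow> 'e set \<Rightarrow> 'v set set" where
  "components G A = verts G // reach G A"

definition rank_of :: "('v, 'e) mgraph \<Rightarrow> 'e set \<Rightarrow> nat" where
  "rank_of G A = card (verts G) - card (components G A)"

abbreviation graph_rank :: "('v, 'e) mgraph \<Rightarrow> nat" where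
  "graph_rank G \<equiv> rank_of G (edges G)"

definition delete :: "('v, 'e) mgraph \<Rightarrow> 'e set \<Rightarrow> ('v, 'e) mgraph" where
  "delete G B = \<lparr>verts = verts G, edges = edges G - B, ends = ends G\<rparr>"

definition contract :: "('v, 'e) mgraph \<Rightarrow> 'e set \<Rightarrow> ('v set, 'e) mgraph" where
  "contract G A =
     \<lparr>verts = components G A,
      edges = edges G - A,
      ends = (\<lambda>e. (\<lambda>v. reach G A `` {v}) ` ends G e)\<rparr>"

definition tutte :: "('v, 'e) mgraph \<Rightarrow> 'k \<Rightarrow> 'k \<Rightarrow> 'k::comm_ring_1" where
  "tutte G x y = (\<Sum>A\<in>Pow (edges G).
     (x - 1) ^ (graph_rank G - rank_of G A) * (y - 1) ^ (card A - rank_of G A))"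


section \<open>Graphs up to isomorphism and 1-sums\<close>

text \<open>
  Every finite graph has a copy on natural numbers, so the classes are formed from such copies.
  The rule \<open>edgeless\<close> follows from the other rules for nonempty graphs; it only serves
  to put the graph without vertices into the class of edgeless graphs.
\<close>

inductive graph_equiv :: "(nat, nat) mgraph \<Rightarrow> (nat, nat) mgraph \<Rightarrow> bool" where
  iso: "\<lbrakk>is_graph G; is_graph H; graph_iso G H\<rbrakk> \<Longrightarrow> graph_equiv G H"
| one_sum: "\<lbrakk>is_graph (G :: (nat, nat) mgraph); is_graph (H :: (nat, nat) mgraph); v \<in> verts G; w \<in> verts H; is_graph K; is_graph L;
     graph_iso K (one_sum G v H w); graph_iso L (disj_union G H)\<rbrakk> \<Longrightarrow> graph_equiv K L"
| edgeless: "\<lbrakk>is_graph G; is_graph H; edges G = {}; edges H = {}\<rbrakk> \<Longrightarrow> graph_equiv G H"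
| sym: "graph_equiv G H \<Longrightarrow> graph_equiv H G"
| trans: "\<lbrakk>graph_equiv G H; graph_equiv H K\<rbrakk> \<Longrightarrow> graph_equiv G K"

definition point_graph :: "(nat, nat) mgraph" where
  "point_graph = \<lparr>verts = {0}, edges = {}, ends = (\<lambda>_. {})\<rparr>"

definition bridge_graph :: "(nat, nat) mgraph" where
  "bridge_graph = \<lparr>verts = {0, 1}, edges = {0}, ends = (\<lambda>_. {0, 1})\<rparr>"

definition loop_graph :: "(nat, nat) mgraph" where
  "loop_graph = \<lparr>verts = {0}, edges = {0}, ends = (\<lambda>_. {0})\<rparr>"

quotient_type gclass = "(nat, nat) mgraph" / partial: graph_equiv
proof (rule part_equivpI)
  have "graph_equiv point_graph point_graph"
    by (rule graph_equiv.edgeless) (simp_all add: point_graph_def is_graph_def)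
  then show "\<exists>G. graph_equiv G G" by blast
  show "symp graph_equiv" by (blast intro: sympI graph_equiv.sym)
  show "transp graph_equiv" by (blast intro: transpI graph_equiv.trans)
qed

definition class_of :: "('v, 'e) mgraph \<Rightarrow> gclass" where
  "class_of G = abs_gclass (SOME H. is_graph H \<and> graph_iso G H)"


section \<open>The coalgebra of graphs and convolution\<close>

text \<open>
  The free module on the classes is \<^typ>\<open>gclass \<Rightarrow>\<^sub>0 'k\<close>, its tensor square is the free module
  \<^typ>\<open>gclass \<times> gclass \<Rightarrow>\<^sub>0 'k\<close> on pairs of classes. The multiplication of the Hopf algebra does
  not enter the convolution of linear forms, in which \<open>m\<close> is the multiplication of the field.
\<close>

type_synonym 'k hg = "gclass \<Rightarrow>\<^sub>0 'k"

definition basis :: "('v, 'e) mgraph \<Rightarrow> 'k::zero_neq_one hg" where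
  "basis G = Poly_Mapping.single (class_of G) 1"

text \<open>
  The coproduct is the linear extension of
  \<open>G \<mapsto> \<Sum>A \<subseteq> E(G). G \ A\<^sup>c \<otimes> G / A\<close>. The sum depends only on the class of \<open>G\<close>, so it is
  computed from a representative.
\<close>

definition coproduct :: "'k::field_char_0 hg \<Rightarrow> (gclass \<times> gclass) \<Rightarrow>\<^sub>0 'k" where
  "coproduct h = (\<Sum>c\<in>Poly_Mapping.keys h. let G = rep_gclass c in
     \<Sum>A\<in>Pow (edges G). Poly_Mapping.single
       (class_of (delete G (edges G - A)), class_of (contract G A)) (Poly_Mapping.lookup h c))"

definition counit :: "'k::field_char_0 hg \<Rightarrow> 'k" where
  "counit h = Poly_Mapping.lookup h (class_of point_graph)"

definition delta_b :: "'k::field_char_0 hg \<Rightarrow> 'k" where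
  "delta_b h = Poly_Mapping.lookup h (class_of bridge_graph)"

definition delta_l :: "'k::field_char_0 hg \<Rightarrow> 'k" where
  "delta_l h = Poly_Mapping.lookup h (class_of loop_graph)"

text \<open>For linear forms \<open>f\<close> and \<open>g\<close>, the linear form \<open>m \<circ> (f \<otimes> g)\<close> on the tensor square.\<close>

definition tensor_form ::
    "('k::field_char_0 hg \<Rightarrow> 'k) \<Rightarrow> ('k hg \<Rightarrow> 'k) \<Rightarrow> ((gclass \<times> gclass) \<Rightarrow>\<^sub>0 'k) \<Rightarrow> 'k" where
  "tensor_form f g t = (\<Sum>(c, d)\<in>Poly_Mapping.keys t. Poly_Mapping.lookup t (c, d) *
     (f (Poly_Mapping.single c 1) * g (Poly_Mapping.single d 1)))"

definition convolution ::
    "('k::field_char_0 hg \<Rightarrow> 'k) \<Rightarrow> ('k hg \<Rightarrow> 'k) \<Rightarrow> 'k hg \<Rightarrow> 'k" where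
  "convolution f g = tensor_form f g \<circ> coproduct"

primrec conv_power :: "('k::field_char_0 hg \<Rightarrow> 'k) \<Rightarrow> nat \<Rightarrow> 'k hg \<Rightarrow> 'k" where
  "conv_power f 0 = counit"
| "conv_power f (Suc k) = convolution f (conv_power f k)"

text \<open>
  The exponential series is a finite sum at every \<open>h\<close> when \<open>f\<close> vanishes on the class of edgeless
  graphs; \<^const>\<open>Sum_any\<close> sums a function of finite support over its whole type.
\<close>

definition conv_exp :: "('k::field_char_0 hg \<Rightarrow> 'k) \<Rightarrow> 'k hg \<Rightarrow> 'k" where
  "conv_exp f h = Sum_any (\<lambda>k. conv_power f k h / fact k)"

definition alpha :: "'k::field_char_0 \<Rightarrow> 'k \<Rightarrow> 'k \<Rightarrow> 'k \<Rightarrow> 'k hg \<Rightarrow> 'k" where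
  "alpha x1 x2 y1 y2 = convolution
     (conv_exp (\<lambda>h. x1 * delta_b h + x2 * delta_l h))
     (conv_exp (\<lambda>h. y1 * delta_b h + y2 * delta_l h))"

end

theory Submission imports Defs begin

text \<open>
  The rank function determines everything: the classes of the edgeless graphs, of the bridge and
  of the loop are those with (size, rank) equal to (0, 0), (1, 1) and (1, 0), and both
  equivalences of graphs (isomorphism and 1-sum) admit a bijection of edges preserving the rank of
  every edge set. As \<open>r(G) = r(A) + r(G/A)\<close>, all \<open>|E|!\<close> orderings of the edges contribute
  the same monomial \<open>x^r(G) y^(|E|-r(G))\<close> to \<open>(x \<delta>\<^sub>b + y \<delta>\<^sub>l)^|E|\<close>, and the other
  convolution powers vanish at \<open>G\<close>. The exponential is therefore that monomial, and the convolution
  of two of them is the subset expansion of the Tutte polynomial.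
\<close>

section \<open>Rank and the span of an edge set\<close>

text \<open>This is membership in the closure of \<open>A\<close> in the cycle matroid. Using the
  square of \<open>ends G e\<close> treats loops and other edges alike, without naming the
  ends.\<close>

definition in_span :: "('v, 'e) mgraph \<Rightarrow> 'e set \<Rightarrow> 'e \<Rightarrow> bool" where
  "in_span G A e \<longleftrightarrow> ends G e \<times> ends G e \<subseteq> reach G A"

lemma is_graphD:
  assumes "is_graph G"
  shows "finite (verts G)" "finite (edges G)"
    "e \<in> edges G \<Longrightarrow> ends G e \<subseteq> verts G" "e \<in> edges G \<Longrightarrow> card (ends G e) \<in> {1, 2}"
  using assms by (auto simp: is_graph_def)

section \<open>Connectivity along an edge set\<close>

lemma reach_refl [simp]: "(u, u) \<in> reach G A"
  by (simp add: reach_def)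

lemma reach_trans: "(u, v) \<in> reach G A \<Longrightarrow> (v, w) \<in> reach G A \<Longrightarrow> (u, w) \<in> reach G A"
  by (auto simp: reach_def)

lemma reach_sym: "(u, v) \<in> reach G A \<Longrightarrow> (v, u) \<in> reach G A"
proof -
  have "sym {(u, v). \<exists>e\<in>A. ends G e = {u, v}}"
    by (auto simp: sym_def insert_commute)
  then show "(u, v) \<in> reach G A \<Longrightarrow> (v, u) \<in> reach G A"
    unfolding reach_def by (meson sym_rtrancl symE)
qed

lemma equiv_reach: "equiv UNIV (reach G A)"
  by (intro equivI) (auto simp: refl_on_def intro: symI transI reach_sym reach_trans)

lemma reach_class_eq_iff: "reach G A `` {u} = reach G A `` {v} \<longleftrightarrow> (u, v) \<in> reach G A"
  using equiv_reach by (metis UNIV_I eq_equiv_class_iff)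

text \<open>It suffices to check single edges, since connectivity is transitive. Gluing maps,
  collapses and choices of representatives are all compared with connectivity through this
  principle.\<close>

lemma reach_map:
  assumes "\<And>e a b. e \<in> A \<Longrightarrow> ends G e = {a, b} \<Longrightarrow> (h a, h b) \<in> reach H B"
    and "(u, v) \<in> reach G A"
  shows "(h u, h v) \<in> reach H B"
  using assms(2) unfolding reach_def[of G]
proof (induction rule: rtrancl_induct)
  case (step y z)
  then have "(h y, h z) \<in> reach H B" using assms(1) by blast
  with step.IH show ?case by (rule reach_trans)
qed simp

text \<open>\<open>reach\<close> only recognizes edges in the form \<open>{a, b}\<close>; as an edge
  has at most two ends, two distinct ones exhaust them.\<close>

lemma edge_in_reach:
  assumes "is_graph G" "e \<in> edges G" "e \<in> A" "a \<in> ends G e" "b \<in> ends G e"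
  shows "(a, b) \<in> reach G A"
proof (cases "a = b")
  case False
  have "card (ends G e) \<le> 2" "finite (ends G e)"
    using is_graphD[OF assms(1)] assms(2) finite_subset by fastforce+
  moreover have "{a, b} \<subseteq> ends G e" using assms by auto
  ultimately have "ends G e = {a, b}"
    using False by (metis card_2_iff card_seteq)
  then show ?thesis using assms(3) unfolding reach_def by blast
qed simp

lemma reach_mono: "A \<subseteq> B \<Longrightarrow> reach G A \<subseteq> reach G B"
  unfolding reach_def by (rule rtrancl_mono) auto

section \<open>Components and the growth of rank\<close>

lemma components_image: "components G A = (\<lambda>x. reach G A `` {x}) ` verts G"
  by (auto simp: components_def quotient_def)

lemma finite_components: "is_graph G \<Longrightarrow> finite (components G A)"
  by (simp add: components_image is_graphD)

lemma card_components_le: "is_graph G \<Longrightarrow> card (components G A) \<le> card (verts G)"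
  by (simp add: components_image card_image_le is_graphD)

lemma reach_empty: "reach G {} = Id"
  by (simp add: reach_def)

lemma rank_of_empty [simp]: "rank_of G {} = 0"
proof -
  have "components G {} = (\<lambda>x. {x}) ` verts G"
    by (simp add: components_image reach_empty)
  then show ?thesis by (simp add: rank_of_def card_image)
qed

lemma reach_insert_in_span:
  assumes "in_span G A e"
  shows "reach G (insert e A) = reach G A"
proof
  show "reach G A \<subseteq> reach G (insert e A)" by (rule reach_mono) auto
  show "reach G (insert e A) \<subseteq> reach G A"
  proof safe
    fix u v assume "(u, v) \<in> reach G (insert e A)"
    moreover have "(a, b) \<in> reach G A" if "f \<in> insert e A" "ends G f = {a, b}" for f a b
    proof (cases "f = e")
      case True
      then show ?thesis using assms that by (auto simp: in_span_def)
    next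
      case False
      then show ?thesis using that by (auto simp: reach_def)
    qed
    ultimately show "(u, v) \<in> reach G A"
      using reach_map[where h = id and A = "insert e A" and G = G and H = G and B = A] by auto
  qed
qed

lemma reach_insert_class:
  fixes G :: "('v, 'e) mgraph" and A :: "'e set"
  assumes "ends G e = {u, v}"
  defines "U \<equiv> reach G A `` {u} \<union> reach G A `` {v}"
  shows "reach G (insert e A) `` {x} = (if x \<in> U then U else reach G A `` {x})"
proof -
  \<comment> \<open>\<open>r\<close> is the expected new connectivity: the two old classes are
    merged into \<open>U\<close>. It is already reflexive and transitive, so taking the closure adds
    nothing.\<close>
  define r where "r = reach G A \<union> U \<times> U"
  have "trans r"
    unfolding r_def U_def by (intro transI) (auto intro: reach_trans reach_sym)
  moreover have "refl r" by (auto simp: r_def refl_on_def)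
  ultimately have r: "r\<^sup>* = r"
    by (simp add: rtrancl_trancl_reflcl trancl_id) (auto simp: refl_on_def)
  have "reach G (insert e A) \<subseteq> r\<^sup>*"
    unfolding reach_def[of G "insert e A"]
  proof (rule rtrancl_mono, safe)
    fix a b f assume f: "ends G f = {a, b}" "f \<in> A"
    then show "(a, b) \<in> r" by (auto simp: r_def reach_def)
  next
    fix a b assume "ends G e = {a, b}"
    then show "(a, b) \<in> r"
      using assms by (auto simp: r_def doubleton_eq_iff)
  qed
  moreover have "r \<subseteq> reach G (insert e A)"
  proof -
    have sub: "reach G A \<subseteq> reach G (insert e A)" by (rule reach_mono) auto
    have uv: "(u, v) \<in> reach G (insert e A)"
      unfolding reach_def using assms(1) by blast
    have "(u, x) \<in> reach G (insert e A)" if "x \<in> U" for x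
      using that sub uv unfolding U_def by (blast intro: reach_trans)
    then show ?thesis
      using sub unfolding r_def by (blast intro: reach_trans reach_sym)
  qed
  ultimately have eq: "reach G (insert e A) = r" using r by auto
  have "reach G A `` U \<subseteq> U"
    unfolding U_def by (auto intro: reach_trans)
  moreover have "y \<in> U" if "x \<in> U" "(x, y) \<in> reach G A" for y
    using that \<open>reach G A `` U \<subseteq> U\<close> by (meson ImageI subsetD)
  ultimately show ?thesis
    unfolding eq r_def by auto
qed

text \<open>An edge outside the span merges exactly two components, and one inside the span merges
  none. Starting from the empty set, the rank function is thus determined by \<open>in_span\<close>
  alone.\<close>

lemma rank_of_insert:
  assumes G: "is_graph G" and e: "e \<in> edges G" and A: "A \<subseteq> edges G"
  shows "rank_of G (insert e A) = (if in_span G A e then rank_of G A else Suc (rank_of G A))"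
proof (cases "in_span G A e")
  case True
  then show ?thesis
    by (simp add: rank_of_def components_def reach_insert_in_span)
next
  case False
  have "card (ends G e) \<in> {1, 2}" using is_graphD[OF G] e by auto
  then obtain u v where uv: "ends G e = {u, v}"
    by (auto simp: card_1_singleton_iff card_2_iff)
  then have V: "u \<in> verts G" "v \<in> verts G" using is_graphD(3)[OF G e] by auto
  have nr: "(u, v) \<notin> reach G A"
    using False uv by (auto simp: in_span_def dest: reach_sym)
  define c where "c x = reach G A `` {x}" for x
  have c_eq: "c x = c y \<longleftrightarrow> (x, y) \<in> reach G A" for x y
    unfolding c_def by (rule reach_class_eq_iff)
  have self: "x \<in> c x" for x by (simp add: c_def)
  have mem: "x \<in> c u \<union> c v \<longleftrightarrow> c x = c u \<or> c x = c v" for x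
    using c_eq by (auto simp: c_def intro: reach_sym)
  have comp: "components G A = c ` verts G"
    by (simp add: components_image c_def)
  have "components G (insert e A) = (\<lambda>x. if x \<in> c u \<union> c v then c u \<union> c v else c x) ` verts G"
    unfolding components_image c_def by (simp only: reach_insert_class[OF uv])
  also have "\<dots> = insert (c u \<union> c v) (components G A - {c u, c v})"
  proof (rule Set.set_eqI)
    fix X
    show "X \<in> (\<lambda>x. if x \<in> c u \<union> c v then c u \<union> c v else c x) ` verts G \<longleftrightarrow>
        X \<in> insert (c u \<union> c v) (components G A - {c u, c v})"
      using V self[of u] unfolding comp mem by (auto simp: image_iff)
  qed
  finally have eq: "components G (insert e A) = insert (c u \<union> c v) (components G A - {c u, c v})" .
  \<comment> \<open>The merged set is no surviving old component: containing \<open>u\<close>, it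
    could only be \<open>c u\<close>. Hence two components are lost and one is gained.\<close>
  have "c u \<union> c v \<notin> components G A - {c u, c v}"
  proof
    assume "c u \<union> c v \<in> components G A - {c u, c v}"
    then obtain x where x: "c u \<union> c v = c x" "c x \<noteq> c u" unfolding comp by auto
    then have "u \<in> c x" using self by auto
    then have "c x = c u" by (simp add: c_eq) (simp add: c_def)
    with x show False by simp
  qed
  then have "card (components G (insert e A)) = Suc (card (components G A - {c u, c v}))"
    unfolding eq using finite_components[OF G] by simp
  moreover have sub: "{c u, c v} \<subseteq> components G A" using V comp by auto
  moreover have "card {c u, c v} = 2" using nr c_eq by simp
  moreover have "2 \<le> card (components G A)"
    using card_mono[OF finite_components[OF G] sub] calculation(3) by simp
  ultimately have "Suc (card (components G (insert e A))) = card (components G A)"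
    by (simp add: card_Diff_subset)
  \<comment> \<open>The subtraction in \<open>rank_of\<close> is truncated; the bound on the number
    of components makes the increment visible.\<close>
  then show ?thesis
    using False card_components_le[OF G, of A] by (simp add: rank_of_def)
qed

text \<open>Adding the edges one at a time, both ranks grow at the same moments. With
  \<open>C\<close> empty this compares two graphs; with \<open>C\<close> a contracted set it gives
  the rank in the contraction.\<close>

lemma rank_of_image_union:
  assumes G: "is_graph G" and H: "is_graph H"
    and E: "E \<subseteq> edges G" "f ` E \<subseteq> edges H" "C \<subseteq> edges H"
    and span: "\<And>A e. A \<subseteq> E \<Longrightarrow> e \<in> E \<Longrightarrow> in_span H (C \<union> f ` A) (f e) \<longleftrightarrow> in_span G A e"
    and A: "A \<subseteq> E"
  shows "rank_of H (C \<union> f ` A) = rank_of H C + rank_of G A"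
proof -
  have "finite A" using A E(1) is_graphD(2)[OF G] by (meson finite_subset)
  then show ?thesis using A
  proof (induction rule: finite_induct)
    case (insert e A)
    have "rank_of H (insert (f e) (C \<union> f ` A)) =
        (if in_span H (C \<union> f ` A) (f e) then rank_of H (C \<union> f ` A) else Suc (rank_of H (C \<union> f ` A)))"
      by (rule rank_of_insert[OF H]) (use insert.prems E in \<open>auto 4 4\<close>)
    moreover have "rank_of G (insert e A) = (if in_span G A e then rank_of G A else Suc (rank_of G A))"
      by (rule rank_of_insert[OF G]) (use insert.prems E in auto)
    ultimately show ?case using insert span by auto
  qed simp
qed

lemma rank_of_le_card:
  assumes G: "is_graph G" and A: "A \<subseteq> edges G"
  shows "rank_of G A \<le> card A"
proof -
  have "finite A" using A is_graphD(2)[OF G] by (meson finite_subset)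
  then show ?thesis using A
    by (induction rule: finite_induct) (auto simp: rank_of_insert[OF G])
qed

section \<open>Deletion and contraction\<close>

lemma is_graph_delete: "is_graph G \<Longrightarrow> is_graph (delete G B)"
  by (auto simp: is_graph_def delete_def)

lemma edges_delete [simp]: "edges (delete G B) = edges G - B"
  by (simp add: delete_def)

lemma rank_of_delete [simp]: "rank_of (delete G B) A = rank_of G A"
  by (simp add: rank_of_def components_def reach_def delete_def)

lemma edges_contract [simp]: "edges (contract G A) = edges G - A"
  by (simp add: contract_def)

lemma is_graph_contract:
  assumes "is_graph G"
  shows "is_graph (contract G A)"
proof -
  have "card ((\<lambda>v. reach G A `` {v}) ` ends G e) \<in> {1, 2}" if "e \<in> edges G" for e
  proof -
    have "card (ends G e) \<in> {1, 2}" using is_graphD(4)[OF assms that] .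
    then obtain u v where "ends G e = {u, v}" by (auto simp: card_1_singleton_iff card_2_iff)
    then show ?thesis by (auto simp: card_insert_if)
  qed
  moreover have "(\<lambda>v. reach G A `` {v}) ` ends G e \<subseteq> components G A" if "e \<in> edges G" for e
    using is_graphD(3)[OF assms that] by (auto simp: components_image)
  ultimately show ?thesis
    using assms finite_components[OF assms] by (simp add: is_graph_def contract_def)
qed

lemma image_eq_doubletonE:
  assumes "h ` S = {a, b}"
  obtains a' b' where "a' \<in> S" "b' \<in> S" "h a' = a" "h b' = b"
proof -
  have "a \<in> h ` S" "b \<in> h ` S" using assms by auto
  then show ?thesis using that by blast
qed

lemma reach_contract_iff:
  assumes G: "is_graph G" and A: "A \<subseteq> edges G" and B: "B \<subseteq> edges G - A"
  shows "(reach G A `` {u}, reach G A `` {v}) \<in> reach (contract G A) B \<longleftrightarrow> (u, v) \<in> reach G (A \<union> B)"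
proof
  let ?c = "\<lambda>v. reach G A `` {v}"
  \<comment> \<open>\<open>h\<close> picks a vertex from each class, which turns a walk in the
    contraction into a connection in \<open>G\<close>: the gaps at the picked vertices are bridged
    inside \<open>A\<close>.\<close>
  define h where "h X = (SOME x. x \<in> X)" for X :: "'a set"
  have sub: "reach G A \<subseteq> reach G (A \<union> B)" by (rule reach_mono) auto
  have h: "(x, h (?c x)) \<in> reach G (A \<union> B)" for x
  proof -
    have "h (?c x) \<in> ?c x"
      unfolding h_def by (rule someI[where x = x]) simp
    then show ?thesis using sub by auto
  qed
  assume "(?c u, ?c v) \<in> reach (contract G A) B"
  then have "(h (?c u), h (?c v)) \<in> reach G (A \<union> B)"
  proof (rule reach_map[rotated])
    fix e X Y assume e: "e \<in> B" "ends (contract G A) e = {X, Y}"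
    then have "?c ` ends G e = {X, Y}" by (simp add: contract_def)
    then obtain a b where ab: "a \<in> ends G e" "b \<in> ends G e" "?c a = X" "?c b = Y"
      by (rule image_eq_doubletonE)
    have "(a, b) \<in> reach G (A \<union> B)"
      by (rule edge_in_reach[OF G]) (use e B ab in auto)
    then show "(h X, h Y) \<in> reach G (A \<union> B)"
      using reach_trans[OF reach_sym[OF h[of a]] reach_trans[OF _ h[of b]]] ab by simp
  qed
  then show "(u, v) \<in> reach G (A \<union> B)"
    using reach_trans[OF h[of u] reach_trans[OF _ reach_sym[OF h[of v]]]] by simp
next
  assume "(u, v) \<in> reach G (A \<union> B)"
  then show "(reach G A `` {u}, reach G A `` {v}) \<in> reach (contract G A) B"
  proof (rule reach_map[rotated])
    fix e a b assume e: "e \<in> A \<union> B" "ends G e = {a, b}"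
    show "(reach G A `` {a}, reach G A `` {b}) \<in> reach (contract G A) B"
    proof (cases "e \<in> A")
      case True
      then have "(a, b) \<in> reach G A" using e by (auto simp: reach_def)
      then have "reach G A `` {a} = reach G A `` {b}" by (simp add: reach_class_eq_iff)
      then show ?thesis by simp
    next
      case False
      then have "e \<in> B" "ends (contract G A) e = {reach G A `` {a}, reach G A `` {b}}"
        using e by (auto simp: contract_def)
      then show ?thesis unfolding reach_def[of "contract G A"] by blast
    qed
  qed
qed

text \<open>By \<open>reach_contract_iff\<close>, \<open>B\<close> spans an edge in the contraction
  exactly when \<open>A \<union> B\<close> spans it in \<open>G\<close>; so the growth of rank
  beyond \<open>A\<close> is the same.\<close>

lemma rank_of_contract:
  assumes G: "is_graph G" and A: "A \<subseteq> edges G" and B: "B \<subseteq> edges G - A"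
  shows "rank_of G (A \<union> B) = rank_of G A + rank_of (contract G A) B"
proof -
  have "rank_of G (A \<union> id ` B) = rank_of G A + rank_of (contract G A) B"
  proof (rule rank_of_image_union[OF is_graph_contract[OF G] G _ _ A _ B])
    fix B e assume "B \<subseteq> edges G - A" "e \<in> edges G - A"
    then show "in_span G (A \<union> id ` B) (id e) \<longleftrightarrow> in_span (contract G A) B e"
      using reach_contract_iff[OF G A, of B]
      by (auto simp: in_span_def contract_def image_subset_iff) blast+
  qed auto
  then show ?thesis by simp
qed

lemma graph_rank_contract:
  assumes "is_graph G" and "A \<subseteq> edges G"
  shows "graph_rank G = rank_of G A + graph_rank (contract G A)"
  using rank_of_contract[OF assms, of "edges G - A"] assms(2) by (simp add: Un_absorb1)

section \<open>Rank-preserving bijections of edges\<close>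

text \<open>This is isomorphism of cycle matroids, expressed by rank functions. It mentions no
  vertices, and can therefore survive the identification of two of them.\<close>

definition rank_equiv :: "('v, 'e) mgraph \<Rightarrow> ('w, 'f) mgraph \<Rightarrow> bool" where
  "rank_equiv G H \<longleftrightarrow> (\<exists>\<psi>. bij_betw \<psi> (edges G) (edges H) \<and>
     (\<forall>A\<subseteq>edges G. rank_of H (\<psi> ` A) = rank_of G A))"

lemma rank_equiv_sym:
  assumes "rank_equiv G H" shows "rank_equiv H G"
proof -
  obtain \<psi> where bij: "bij_betw \<psi> (edges G) (edges H)"
    and rk: "\<And>A. A \<subseteq> edges G \<Longrightarrow> rank_of H (\<psi> ` A) = rank_of G A"
    using assms by (auto simp: rank_equiv_def)
  let ?i = "inv_into (edges G) \<psi>"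
  have bi: "bij_betw ?i (edges H) (edges G)" using bij by (rule bij_betw_inv_into)
  moreover have "rank_of G (?i ` B) = rank_of H B" if B: "B \<subseteq> edges H" for B
  proof -
    have "?i ` B \<subseteq> edges G" using B bi by (auto simp: bij_betw_def)
    moreover have "\<psi> ` ?i ` B = B"
      using B bij by (simp add: bij_betw_def image_inv_into_cancel)
    ultimately show ?thesis using rk[of "?i ` B"] by simp
  qed
  ultimately show ?thesis unfolding rank_equiv_def by blast
qed

lemma rank_equiv_trans:
  assumes "rank_equiv G H" "rank_equiv H K" shows "rank_equiv G K"
proof -
  obtain \<psi> where bij: "bij_betw \<psi> (edges G) (edges H)"
    and rk: "\<And>A. A \<subseteq> edges G \<Longrightarrow> rank_of H (\<psi> ` A) = rank_of G A"
    using assms(1) by (auto simp: rank_equiv_def)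
  obtain \<psi>' where bij': "bij_betw \<psi>' (edges H) (edges K)"
    and rk': "\<And>A. A \<subseteq> edges H \<Longrightarrow> rank_of K (\<psi>' ` A) = rank_of H A"
    using assms(2) by (auto simp: rank_equiv_def)
  have "bij_betw (\<psi>' \<circ> \<psi>) (edges G) (edges K)" using bij bij' by (rule bij_betw_trans)
  moreover have "rank_of K ((\<psi>' \<circ> \<psi>) ` A) = rank_of G A" if A: "A \<subseteq> edges G" for A
  proof -
    have "\<psi> ` A \<subseteq> edges H" using A bij by (auto simp: bij_betw_def)
    then show ?thesis using rk[OF A] rk'[of "\<psi> ` A"] by (simp only: image_comp)
  qed
  ultimately show ?thesis unfolding rank_equiv_def by blast
qed

lemma rank_equiv_if_span:
  assumes "is_graph G" "is_graph H" and bij: "bij_betw \<psi> (edges G) (edges H)"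
    and "\<And>A e. A \<subseteq> edges G \<Longrightarrow> e \<in> edges G \<Longrightarrow> in_span H (\<psi> ` A) (\<psi> e) \<longleftrightarrow> in_span G A e"
  shows "rank_equiv G H"
proof -
  have "rank_of H ({} \<union> \<psi> ` A) = rank_of H {} + rank_of G A" if "A \<subseteq> edges G" for A
    by (rule rank_of_image_union[OF assms(1,2) subset_refl _ _ _ that])
      (use assms in \<open>auto simp: bij_betw_def\<close>)
  then show ?thesis unfolding rank_equiv_def using bij by auto
qed

section \<open>Isomorphic graphs have the same rank function\<close>

lemma graph_isoI:
  assumes "bij_betw \<phi> (verts G) (verts H)" "bij_betw \<psi> (edges G) (edges H)"
    and "\<And>e. e \<in> edges G \<Longrightarrow> ends H (\<psi> e) = \<phi> ` ends G e"
  shows "graph_iso G H"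
  using assms unfolding graph_iso_def by blast

lemma is_graph_iso:
  assumes "is_graph G" "graph_iso G H" shows "is_graph H"
proof -
  obtain \<phi> \<psi> where iso: "bij_betw \<phi> (verts G) (verts H)" "bij_betw \<psi> (edges G) (edges H)"
    "\<And>e. e \<in> edges G \<Longrightarrow> ends H (\<psi> e) = \<phi> ` ends G e"
    using assms(2) by (auto simp: graph_iso_def)
  have "ends H f \<subseteq> verts H \<and> card (ends H f) \<in> {1, 2}" if f: "f \<in> edges H" for f
  proof -
    obtain e where e: "e \<in> edges G" "f = \<psi> e" using f iso(2) by (auto simp: bij_betw_def)
    have sub: "ends G e \<subseteq> verts G" and c: "card (ends G e) \<in> {1, 2}"
      using is_graphD[OF assms(1)] e by auto
    have "card (\<phi> ` ends G e) = card (ends G e)"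
      by (rule card_image) (use iso(1) sub in \<open>auto simp: bij_betw_def intro: inj_on_subset\<close>)
    moreover have "\<phi> ` ends G e \<subseteq> verts H" using sub iso(1) by (auto simp: bij_betw_def)
    ultimately show ?thesis using iso(3) e c by simp
  qed
  then show ?thesis
    using assms(1) iso(1,2) by (auto simp: is_graph_def bij_betw_finite)
qed

lemma rank_equiv_iso:
  assumes G: "is_graph G" and "graph_iso G H"
  shows "rank_equiv G H"
proof -
  have H: "is_graph H" using assms by (rule is_graph_iso)
  obtain \<phi> \<psi> where iso: "bij_betw \<phi> (verts G) (verts H)" "bij_betw \<psi> (edges G) (edges H)"
    "\<And>e. e \<in> edges G \<Longrightarrow> ends H (\<psi> e) = \<phi> ` ends G e"
    using assms(2) by (auto simp: graph_iso_def)
  let ?i = "inv_into (verts G) \<phi>"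
  have inv: "?i (\<phi> a) = a" if "a \<in> verts G" for a
    using iso(1) that by (simp add: bij_betw_def)
  show ?thesis
  proof (rule rank_equiv_if_span[OF G H iso(2)])
    fix A e assume A: "A \<subseteq> edges G" and e: "e \<in> edges G"
    have fwd: "(\<phi> a, \<phi> b) \<in> reach H (\<psi> ` A)" if "(a, b) \<in> reach G A" for a b
      using that
    proof (rule reach_map[rotated])
      fix e a b assume "e \<in> A" "ends G e = {a, b}"
      then show "(\<phi> a, \<phi> b) \<in> reach H (\<psi> ` A)"
        using iso(3)[of e] A unfolding reach_def by (intro r_into_rtrancl) auto
    qed
    \<comment> \<open>The inverse is only meaningful on images of vertices, but only ends of edges
      have to be pulled back. A pair \<open>(a, a)\<close> is in \<open>reach\<close> for any
      \<open>a\<close>, so no membership assumption is needed.\<close>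
    have bwd: "(?i a, ?i b) \<in> reach G A" if "(a, b) \<in> reach H (\<psi> ` A)" for a b
      using that
    proof (rule reach_map[rotated])
      fix f a b assume f: "f \<in> \<psi> ` A" "ends H f = {a, b}"
      then obtain e where e: "e \<in> A" "f = \<psi> e" by auto
      then have eq: "\<phi> ` ends G e = {a, b}" using f iso(3)[of e] A by auto
      then obtain a' b' where ab: "a' \<in> ends G e" "b' \<in> ends G e" "\<phi> a' = a" "\<phi> b' = b"
        by (rule image_eq_doubletonE)
      then have "a' \<in> verts G" "b' \<in> verts G" using is_graphD(3)[OF G] e A by auto
      moreover have "(a', b') \<in> reach G A"
        by (rule edge_in_reach[OF G]) (use e A ab in auto)
      ultimately show "(?i a, ?i b) \<in> reach G A" using inv ab by auto
    qed
    have sub: "ends G e \<subseteq> verts G" using is_graphD(3)[OF G e] .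
    show "in_span H (\<psi> ` A) (\<psi> e) \<longleftrightarrow> in_span G A e"
    proof
      assume "in_span G A e"
      then show "in_span H (\<psi> ` A) (\<psi> e)" using fwd iso(3)[OF e] by (auto simp: in_span_def)
    next
      assume L: "in_span H (\<psi> ` A) (\<psi> e)"
      have "(a, b) \<in> reach G A" if "a \<in> ends G e" "b \<in> ends G e" for a b
      proof -
        have "(\<phi> a, \<phi> b) \<in> reach H (\<psi> ` A)" using L that iso(3)[OF e] by (auto simp: in_span_def)
        then show ?thesis using bwd[of "\<phi> a" "\<phi> b"] by (simp add: inv subsetD[OF sub] that)
      qed
      then show "in_span G A e" by (auto simp: in_span_def)
    qed
  qed
qed

section \<open>Disjoint unions and 1-sums\<close>

lemma edges_disj_union: "edges (disj_union G H) = Inl ` edges G \<union> Inr ` edges H"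
  by (simp add: disj_union_def)

lemma edges_one_sum: "edges (one_sum G v H w) = Inl ` edges G \<union> Inr ` edges H"
  by (simp add: one_sum_def)

lemma ends_disj_union [simp]:
  "ends (disj_union G H) (Inl e) = Inl ` ends G e"
  "ends (disj_union G H) (Inr f) = Inr ` ends H f"
  by (simp_all add: disj_union_def)

lemma ends_one_sum [simp]:
  "ends (one_sum G v H w) (Inl e) = Inl ` ends G e"
  "ends (one_sum G v H w) (Inr f) = (\<lambda>u. if u = w then Inl v else Inr u) ` ends H f"
  by (simp_all add: one_sum_def)

text \<open>Collapsing either summand of the 1-sum to the common vertex is a retraction onto the
  other one, so identifying the two vertices creates no new connection inside a summand.\<close>

lemma in_span_one_sum_iff:
  assumes D: "is_graph (disj_union G H)" and A: "A \<subseteq> edges (disj_union G H)"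
  shows "in_span (one_sum G v H w) A e \<longleftrightarrow> in_span (disj_union G H) A e"
proof -
  let ?D = "disj_union G H" and ?S = "one_sum G v H w"
  \<comment> \<open>\<open>h\<close> is the gluing map; \<open>p\<close> collapses the second
    summand to the common vertex, seen as \<open>Inl v\<close>, and \<open>q\<close> the first one,
    seen as \<open>Inr w\<close>.\<close>
  define h where "h = case_sum Inl (\<lambda>u. if u = w then Inl v else Inr u)"
  define p :: "'a + 'b \<Rightarrow> 'a + 'b" where "p = case_sum Inl (\<lambda>_. Inl v)"
  define q :: "'a + 'b \<Rightarrow> 'a + 'b" where "q = case_sum (\<lambda>_. Inr w) Inr"
  have ends_h: "ends ?S f = h ` ends ?D f" for f
    by (cases f) (auto simp: h_def image_comp)
  have pq: "p (h x) = (if isl x then x else Inl v)" "q (h x) = (if isl x then Inr w else x)" for x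
    by (cases x; simp add: p_def q_def h_def)+
  have fwd: "(h a, h b) \<in> reach ?S A" if "(a, b) \<in> reach ?D A" for a b
    using that
  proof (rule reach_map[rotated])
    fix f a b assume "f \<in> A" "ends ?D f = {a, b}"
    then show "(h a, h b) \<in> reach ?S A"
      using ends_h[of f] unfolding reach_def by (intro r_into_rtrancl) auto
  qed
  have bwd: "(p a, p b) \<in> reach ?D A \<and> (q a, q b) \<in> reach ?D A" if "(a, b) \<in> reach ?S A" for a b
  proof -
    have step: "(p a, p b) \<in> reach ?D A \<and> (q a, q b) \<in> reach ?D A"
      if f: "f \<in> A" "ends ?S f = {a, b}" for f a b
    proof -
      obtain a' b' where ab: "a' \<in> ends ?D f" "b' \<in> ends ?D f" "h a' = a" "h b' = b"
        using f(2) unfolding ends_h by (rule image_eq_doubletonE)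
      have R: "(a', b') \<in> reach ?D A"
        by (rule edge_in_reach[OF D]) (use A f ab in auto)
      \<comment> \<open>Both ends lie in the same summand, so each collapse either keeps the pair or
        sends it to a single vertex.\<close>
      have "isl a' = isl b'" using ab(1,2) by (cases f) auto
      then show ?thesis using R ab(3,4) pq[of a'] pq[of b'] by auto
    qed
    show ?thesis
      using reach_map[of A ?S p ?D A a b] reach_map[of A ?S q ?D A a b] step that by blast
  qed
  show ?thesis
  proof
    assume L: "in_span ?S A e"
    have "(a, b) \<in> reach ?D A" if ab: "a \<in> ends ?D e" "b \<in> ends ?D e" for a b
    proof -
      have "(h a, h b) \<in> reach ?S A" using L ab ends_h by (auto simp: in_span_def)
      moreover have "isl a = isl b" using ab by (cases e) auto
      ultimately show ?thesis using bwd[of "h a" "h b"] pq[of a] pq[of b] by (auto split: if_splits)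
    qed
    then show "in_span ?D A e" by (auto simp: in_span_def)
  next
    assume "in_span ?D A e"
    then show "in_span ?S A e" using fwd by (auto simp: in_span_def ends_h)
  qed
qed

lemma rank_equiv_one_sum:
  assumes "is_graph (disj_union G H)" "is_graph (one_sum G v H w)"
  shows "rank_equiv (one_sum G v H w) (disj_union G H)"
  by (rule rank_equiv_if_span[OF assms(2,1), where \<psi> = id])
    (use assms in \<open>simp_all add: in_span_one_sum_iff edges_one_sum edges_disj_union\<close>)

text \<open>This makes rank and size invariants of classes: each generating rule of the equivalence
  preserves the rank function.\<close>

lemma rank_equiv_graph_equiv: "graph_equiv G H \<Longrightarrow> rank_equiv G H"
proof (induction rule: graph_equiv.induct)
  case (one_sum G H v w K L)
  \<comment> \<open>The chain runs from \<open>K\<close> over the 1-sum and the disjoint union to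
    \<open>L\<close>. That the middle two are graphs is inherited along the isomorphisms.\<close>
  then show ?case
    by (meson is_graph_iso rank_equiv_iso rank_equiv_one_sum rank_equiv_sym rank_equiv_trans)
next
  case (edgeless G H)
  then show ?case by (auto simp: rank_equiv_def)
qed (auto intro: rank_equiv_iso rank_equiv_sym rank_equiv_trans)

lemma graph_equiv_is_graph: "graph_equiv G H \<Longrightarrow> is_graph G \<and> is_graph H"
  by (induction rule: graph_equiv.induct) auto

lemma rank_equiv_graph_rank: "rank_equiv G H \<Longrightarrow> graph_rank H = graph_rank G"
  by (auto simp: rank_equiv_def bij_betw_def)

lemma rank_equiv_card_edges: "rank_equiv G H \<Longrightarrow> card (edges H) = card (edges G)"
  by (metis rank_equiv_def bij_betw_same_card)

text \<open>Taking images under the edge bijection permutes the subsets and preserves rank and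
  cardinality. This moves a subset expansion from a class representative back to the graph
  itself.\<close>

lemma rank_equiv_sum:
  assumes "rank_equiv G H"
  shows "(\<Sum>A\<in>Pow (edges H). F (rank_of H A) (card A)) = (\<Sum>A\<in>Pow (edges G). F (rank_of G A) (card A))"
proof -
  obtain \<psi> where bij: "bij_betw \<psi> (edges G) (edges H)"
    and rk: "\<And>A. A \<subseteq> edges G \<Longrightarrow> rank_of H (\<psi> ` A) = rank_of G A"
    using assms by (auto simp: rank_equiv_def)
  have "bij_betw (image \<psi>) (Pow (edges G)) (Pow (edges H))" using bij by (rule bij_betw_Pow)
  then have "(\<Sum>A\<in>Pow (edges H). F (rank_of H A) (card A)) =
      (\<Sum>A\<in>Pow (edges G). F (rank_of H (\<psi> ` A)) (card (\<psi> ` A)))"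
    by (rule sum.reindex_bij_betw[symmetric])
  also have "\<dots> = (\<Sum>A\<in>Pow (edges G). F (rank_of G A) (card A))"
    by (rule sum.cong)
      (use bij rk in \<open>auto simp: bij_betw_def card_image inj_on_subset\<close>)
  finally show ?thesis .
qed

section \<open>Classes of graphs\<close>

text \<open>Numbering vertices and edges provides the witness for the choice in
  \<open>class_of\<close>.\<close>

lemma graph_iso_nat_copy:
  assumes G: "is_graph G"
  obtains H :: "(nat, nat) mgraph" where "is_graph H" "graph_iso G H"
proof -
  obtain \<phi> where \<phi>: "bij_betw \<phi> (verts G) {0..<card (verts G)}"
    using ex_bij_betw_finite_nat is_graphD(1)[OF G] by blast
  obtain \<psi> where \<psi>: "bij_betw \<psi> (edges G) {0..<card (edges G)}"
    using ex_bij_betw_finite_nat is_graphD(2)[OF G] by blast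
  define H where "H = \<lparr>verts = {0..<card (verts G)}, edges = {0..<card (edges G)},
    ends = (\<lambda>f. \<phi> ` ends G (inv_into (edges G) \<psi> f))\<rparr>"
  have "graph_iso G H"
    by (rule graph_isoI[of \<phi> _ _ \<psi>]) (use \<phi> \<psi> in \<open>simp_all add: H_def bij_betw_def\<close>)
  then show ?thesis using that is_graph_iso[OF G] by blast
qed

lemma abs_gclass_eq_iff:
  assumes "is_graph G" "is_graph H"
  shows "abs_gclass G = abs_gclass H \<longleftrightarrow> graph_equiv G H"
proof -
  have "graph_equiv K K" if "is_graph K" for K
    by (rule graph_equiv.iso[OF that that]) (rule graph_isoI[of id _ _ id], simp_all)
  then show ?thesis using assms Quotient3_rel[OF Quotient3_gclass, of G H] by simp
qed

lemma is_graph_rep: "is_graph (rep_gclass c)"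
  using Quotient3_rep_reflp[OF Quotient3_gclass] graph_equiv_is_graph by blast

lemma abs_rep_gclass: "abs_gclass (rep_gclass c) = c"
  by (rule Quotient3_abs_rep[OF Quotient3_gclass])

lemma class_of_copy:
  assumes "is_graph G"
  obtains H where "is_graph H" "graph_iso G H" "class_of G = abs_gclass H"
proof -
  have "\<exists>H :: (nat, nat) mgraph. is_graph H \<and> graph_iso G H"
    using graph_iso_nat_copy[OF assms] by metis
  from someI_ex[OF this] show ?thesis
    using that unfolding class_of_def by blast
qed

lemma class_of_nat:
  assumes "is_graph (G :: (nat, nat) mgraph)"
  shows "class_of G = abs_gclass G"
proof -
  obtain H where "is_graph H" "graph_iso G H" "class_of G = abs_gclass H"
    using class_of_copy[OF assms] by blast
  then show ?thesis using assms abs_gclass_eq_iff graph_equiv.iso by metis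
qed

text \<open>Two arbitrary choices are absorbed here: the copy on natural numbers in
  \<open>class_of\<close> and the representative of its class.\<close>

lemma rank_equiv_rep_class:
  assumes "is_graph G"
  shows "rank_equiv G (rep_gclass (class_of G))"
proof -
  obtain H where H: "is_graph H" "graph_iso G H" "class_of G = abs_gclass H"
    using class_of_copy[OF assms] by blast
  have "graph_equiv H (rep_gclass (class_of G))"
    using H abs_gclass_eq_iff[OF H(1) is_graph_rep] abs_rep_gclass by metis
  then show ?thesis
    using rank_equiv_iso[OF assms H(2)] rank_equiv_graph_equiv rank_equiv_trans by blast
qed

definition class_rank :: "gclass \<Rightarrow> nat" where
  "class_rank c = graph_rank (rep_gclass c)"

definition class_size :: "gclass \<Rightarrow> nat" where
  "class_size c = card (edges (rep_gclass c))"

lemma class_rank_class_of [simp]: "is_graph G \<Longrightarrow> class_rank (class_of G) = graph_rank G"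
  unfolding class_rank_def by (rule rank_equiv_graph_rank[OF rank_equiv_rep_class])

lemma class_size_class_of [simp]: "is_graph G \<Longrightarrow> class_size (class_of G) = card (edges G)"
  unfolding class_size_def by (rule rank_equiv_card_edges[OF rank_equiv_rep_class])

lemma class_rank_le_size: "class_rank c \<le> class_size c"
  unfolding class_rank_def class_size_def by (rule rank_of_le_card[OF is_graph_rep]) simp

lemma class_eqI:
  assumes "is_graph H" "graph_equiv (rep_gclass c) H"
  shows "c = class_of H"
  using assms abs_gclass_eq_iff[OF is_graph_rep] abs_rep_gclass class_of_nat by metis

section \<open>The classes with at most one edge\<close>

lemma is_graph_point: "is_graph point_graph"
  and is_graph_bridge: "is_graph bridge_graph"
  and is_graph_loop: "is_graph loop_graph"
  by (simp_all add: is_graph_def point_graph_def bridge_graph_def loop_graph_def)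

lemma edges_small_graphs [simp]:
  "edges point_graph = {}" "edges bridge_graph = {0}" "edges loop_graph = {0}"
  by (simp_all add: point_graph_def bridge_graph_def loop_graph_def)

text \<open>A graph is the 1-sum of itself with a point, and a disjoint union with a point
  adds an isolated vertex.\<close>

lemma graph_equiv_insert_vertex:
  assumes G: "is_graph G" and V: "verts G \<noteq> {}" and x: "x \<notin> verts G"
  shows "graph_equiv G (G\<lparr>verts := insert x (verts G)\<rparr>)"
proof -
  obtain v where v: "v \<in> verts G" using V by blast
  have S: "graph_iso G (one_sum G v point_graph 0)"
    by (rule graph_isoI[of Inl _ _ Inl]) (simp_all add: one_sum_def point_graph_def bij_betw_def)
  let ?L = "G\<lparr>verts := insert x (verts G)\<rparr>"
  let ?\<phi> = "\<lambda>u. if u = x then Inr 0 else Inl u :: nat + nat"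
  have L: "is_graph ?L" using G by (auto simp: is_graph_def)
  have "graph_iso ?L (disj_union G point_graph)"
  proof (rule graph_isoI[of ?\<phi> _ _ Inl])
    show "bij_betw ?\<phi> (verts ?L) (verts (disj_union G point_graph))"
      using x by (auto simp: bij_betw_def inj_on_def disj_union_def point_graph_def)
    show "bij_betw Inl (edges ?L) (edges (disj_union G point_graph))"
      by (simp add: bij_betw_def disj_union_def point_graph_def)
    fix e assume "e \<in> edges ?L"
    then have "x \<notin> ends G e" using x is_graphD(3)[OF G] by auto
    then show "ends (disj_union G point_graph) (Inl e) = ?\<phi> ` ends ?L e"
      by (auto intro!: image_cong)
  qed
  then show ?thesis
    using graph_equiv.one_sum[OF G is_graph_point v _ G L S] by (simp add: point_graph_def)
qed

lemma graph_equiv_add_vertices: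
  assumes "finite S" and G: "is_graph G" and V: "verts G \<noteq> {}"
  shows "graph_equiv G (G\<lparr>verts := S \<union> verts G\<rparr>)"
  using assms(1)
proof (induction rule: finite_induct)
  case empty
  show ?case using G abs_gclass_eq_iff[OF G G] by simp
next
  case (insert x S)
  let ?H = "G\<lparr>verts := S \<union> verts G\<rparr>"
  show ?case
  proof (cases "x \<in> verts G")
    case True
    then have "insert x S \<union> verts G = S \<union> verts G" by auto
    then show ?thesis using insert.IH by simp
  next
    case False
    have "graph_equiv ?H (?H\<lparr>verts := insert x (verts ?H)\<rparr>)"
      by (rule graph_equiv_insert_vertex) (use False insert V G in \<open>auto simp: is_graph_def\<close>)
    then show ?thesis using graph_equiv.trans[OF insert.IH] by simp
  qed
qed

lemma single_edge_graph_equiv: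
  assumes G: "is_graph G" and E: "edges G = {e}"
  shows "graph_equiv G (if card (ends G e) = 1 then loop_graph else bridge_graph)"
proof -
  \<comment> \<open>\<open>?G\<close> drops all isolated vertices; adding them back does not change
    the class, so only the ends of \<open>e\<close> matter.\<close>
  let ?G = "G\<lparr>verts := ends G e\<rparr>"
  have V: "ends G e \<subseteq> verts G" "card (ends G e) \<in> {1, 2}" "finite (verts G)"
    using is_graphD[OF G] E by auto
  have G': "is_graph ?G" using G E V finite_subset by (auto simp: is_graph_def)
  have "graph_equiv ?G (?G\<lparr>verts := verts G \<union> verts ?G\<rparr>)"
    by (rule graph_equiv_add_vertices) (use V G' in auto)
  moreover have "?G\<lparr>verts := verts G \<union> verts ?G\<rparr> = G" using V by (simp add: Un_absorb2)
  ultimately have *: "graph_equiv G ?G" by (simp add: graph_equiv.sym)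
  show ?thesis
  proof (cases "card (ends G e) = 1")
    case True
    then obtain u where u: "ends G e = {u}" by (auto simp: card_1_singleton_iff)
    have "graph_iso ?G loop_graph"
      by (rule graph_isoI[of "\<lambda>_. 0" _ _ "\<lambda>_. 0"]) (simp_all add: u E loop_graph_def bij_betw_def)
    then show ?thesis
      using True * graph_equiv.iso[OF G' is_graph_loop] graph_equiv.trans by auto
  next
    case False
    then obtain u v where u: "ends G e = {u, v}" "u \<noteq> v" using V by (auto simp: card_2_iff)
    have "graph_iso ?G bridge_graph"
      by (rule graph_isoI[of "\<lambda>x. if x = u then 0 else 1" _ _ "\<lambda>_. 0"])
        (use u in \<open>auto simp: E bridge_graph_def bij_betw_def\<close>)
    then show ?thesis
      using False * graph_equiv.iso[OF G' is_graph_bridge] graph_equiv.trans by auto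
  qed
qed

lemma rank_of_singleton:
  assumes "is_graph G" "e \<in> edges G"
  shows "rank_of G {e} = (if card (ends G e) = 1 then 0 else 1)"
proof -
  have "card (ends G e) \<in> {1, 2}" using is_graphD(4)[OF assms] .
  then obtain u v where "ends G e = {u, v}"
    by (auto simp: card_1_singleton_iff card_2_iff)
  then have "in_span G {} e \<longleftrightarrow> card (ends G e) = 1"
    by (auto simp: in_span_def reach_empty card_insert_if)
  then show ?thesis using rank_of_insert[OF assms, of "{}"] by simp
qed

text \<open>The representative may have no vertices at all; the rule \<open>edgeless\<close> covers
  that case too.\<close>

lemma eq_class_point_iff: "c = class_of point_graph \<longleftrightarrow> class_size c = 0"
proof
  assume "c = class_of point_graph"
  then show "class_size c = 0" using is_graph_point by simp
next
  assume "class_size c = 0"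
  then have "edges (rep_gclass c) = {}"
    using is_graphD(2)[OF is_graph_rep] by (simp add: class_size_def)
  then show "c = class_of point_graph"
    by (intro class_eqI is_graph_point graph_equiv.edgeless is_graph_rep)
      simp_all
qed

lemma single_edge_class:
  assumes "class_size c = 1"
  shows "c = class_of (if class_rank c = 0 then loop_graph else bridge_graph)"
proof -
  obtain e where e: "edges (rep_gclass c) = {e}"
    using assms by (auto simp: class_size_def card_1_singleton_iff)
  then have "class_rank c = 0 \<longleftrightarrow> card (ends (rep_gclass c) e) = 1"
    using rank_of_singleton[OF is_graph_rep, of e c] by (simp add: class_rank_def)
  then show ?thesis
    using single_edge_graph_equiv[OF is_graph_rep e] is_graph_loop is_graph_bridge
    by (intro class_eqI) auto
qed

text \<open>This and \<open>eq_class_loop_iff\<close> turn the two infinitesimal forms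
  \<open>delta_b\<close> and \<open>delta_l\<close> into conditions on size and rank.\<close>

lemma eq_class_bridge_iff: "c = class_of bridge_graph \<longleftrightarrow> class_size c = 1 \<and> class_rank c = 1"
proof
  assume c: "c = class_of bridge_graph"
  have "rank_of bridge_graph {0} = 1"
    by (subst rank_of_singleton[OF is_graph_bridge]) (simp_all, simp add: bridge_graph_def)
  then show "class_size c = 1 \<and> class_rank c = 1"
    unfolding c using is_graph_bridge by simp
next
  assume "class_size c = 1 \<and> class_rank c = 1"
  then show "c = class_of bridge_graph" using single_edge_class[of c] by simp
qed

lemma eq_class_loop_iff: "c = class_of loop_graph \<longleftrightarrow> class_size c = 1 \<and> class_rank c = 0"
proof
  assume c: "c = class_of loop_graph"
  have "rank_of loop_graph {0} = 0"
    by (subst rank_of_singleton[OF is_graph_loop]) (simp_all, simp add: loop_graph_def)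
  then show "class_size c = 1 \<and> class_rank c = 0"
    unfolding c using is_graph_loop by simp
next
  assume "class_size c = 1 \<and> class_rank c = 0"
  then show "c = class_of loop_graph" using single_edge_class[of c] by simp
qed

section \<open>Convolution of forms depending on rank and size\<close>

text \<open>Different indices may give the same pair of classes, so the coefficients count
  multiplicities. Exchanging the two sums distributes them back over the indices.\<close>

lemma tensor_form_sum_single:
  fixes f g :: "'k::field_char_0 hg \<Rightarrow> 'k"
  assumes "finite I"
  shows "tensor_form f g (\<Sum>a\<in>I. Poly_Mapping.single (p a, q a) 1) =
    (\<Sum>a\<in>I. f (Poly_Mapping.single (p a) 1) * g (Poly_Mapping.single (q a) 1))"
proof -
  let ?t = "\<Sum>a\<in>I. Poly_Mapping.single (p a, q a) (1 :: 'k)"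
  let ?k = "\<lambda>a. (p a, q a)"
  define F where "F x = f (Poly_Mapping.single (fst x) 1) * g (Poly_Mapping.single (snd x) 1)" for x
  have lk: "Poly_Mapping.lookup ?t x = (\<Sum>a\<in>I. if ?k a = x then 1 else 0)" for x
    by (simp add: lookup_sum lookup_single when_def)
  have "Poly_Mapping.keys ?t \<subseteq> ?k ` I"
  proof
    fix x assume "x \<in> Poly_Mapping.keys ?t"
    then have "(\<Sum>a\<in>I. if ?k a = x then 1 else 0 :: 'k) \<noteq> 0"
      unfolding in_keys_iff lk .
    then obtain a where "a \<in> I" "(if ?k a = x then 1 else 0 :: 'k) \<noteq> 0"
      by (rule sum.not_neutral_contains_not_neutral)
    then show "x \<in> ?k ` I" by (cases "?k a = x") auto
  qed
  \<comment> \<open>Pairs in the image that are not keys have coefficient zero, so the sum may be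
    extended to the image.\<close>
  then have "tensor_form f g ?t = (\<Sum>x\<in>?k ` I. Poly_Mapping.lookup ?t x * F x)"
    unfolding tensor_form_def F_def case_prod_unfold prod.collapse
    by (intro sum.mono_neutral_left) (use assms in \<open>auto simp: in_keys_iff\<close>)
  also have "\<dots> = (\<Sum>x\<in>?k ` I. \<Sum>a\<in>I. if ?k a = x then F x else 0)"
    unfolding lk sum_distrib_right by (intro sum.cong refl) auto
  also have "\<dots> = (\<Sum>a\<in>I. \<Sum>x\<in>?k ` I. if ?k a = x then F x else 0)"
    by (rule sum.swap)
  also have "\<dots> = (\<Sum>a\<in>I. F (?k a))"
    using assms by (intro sum.cong refl) (simp add: sum.delta')
  finally show ?thesis by (simp add: F_def)
qed

lemma coproduct_single:
  "coproduct (Poly_Mapping.single c 1) = (\<Sum>A\<in>Pow (edges (rep_gclass c)).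
     Poly_Mapping.single (class_of (delete (rep_gclass c) (edges (rep_gclass c) - A)),
       class_of (contract (rep_gclass c) A)) 1)"
  by (simp add: coproduct_def Let_def)

text \<open>The left tensor factor has rank \<open>rank_of R A\<close> and size
  \<open>card A\<close>; the right one has what remains of both, by
  \<open>graph_rank_contract\<close>.\<close>

lemma convolution_single:
  fixes f g :: "'k::field_char_0 hg \<Rightarrow> 'k" and c :: gclass
  assumes f: "\<And>d. f (Poly_Mapping.single d 1) = F (class_rank d) (class_size d)"
    and g: "\<And>d. g (Poly_Mapping.single d 1) = F' (class_rank d) (class_size d)"
  defines "R \<equiv> rep_gclass c"
  shows "convolution f g (Poly_Mapping.single c 1) = (\<Sum>A\<in>Pow (edges R).
    F (rank_of R A) (card A) * F' (class_rank c - rank_of R A) (class_size c - card A))"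
proof -
  have R: "is_graph R" unfolding R_def by (rule is_graph_rep)
  note fin = is_graphD(2)[OF R]
  have "f (Poly_Mapping.single (class_of (delete R (edges R - A))) 1) *
      g (Poly_Mapping.single (class_of (contract R A)) 1) =
      F (rank_of R A) (card A) * F' (class_rank c - rank_of R A) (class_size c - card A)"
    if A: "A \<subseteq> edges R" for A
  proof -
    have "edges R - (edges R - A) = A" using A by auto
    moreover have "graph_rank (contract R A) = class_rank c - rank_of R A"
      using graph_rank_contract[OF R A] unfolding class_rank_def R_def by simp
    moreover have "card (edges R - A) = class_size c - card A"
      using card_Diff_subset[OF finite_subset[OF A fin] A] by (simp add: class_size_def R_def)
    ultimately show ?thesis
      using is_graph_delete[OF R] is_graph_contract[OF R] by (simp add: f g)
  qed
  then show ?thesis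
    unfolding convolution_def comp_def coproduct_single R_def[symmetric]
    using fin by (simp add: tensor_form_sum_single)
qed

text \<open>These bounds make the truncated subtractions in the exponents genuine. The third is
  \<open>rank_of_le_card\<close> applied to the contraction.\<close>

lemma rank_of_bounds:
  assumes G: "is_graph G" and A: "A \<subseteq> edges G"
  shows "rank_of G A \<le> graph_rank G" "rank_of G A \<le> card A"
    "graph_rank G - rank_of G A \<le> card (edges G) - card A" "card A \<le> card (edges G)"
proof -
  note fin = is_graphD(2)[OF G]
  have "graph_rank (contract G A) \<le> card (edges G - A)"
    using rank_of_le_card[OF is_graph_contract[OF G], of "edges G - A" A] by simp
  then show "rank_of G A \<le> graph_rank G" "graph_rank G - rank_of G A \<le> card (edges G) - card A"
    using graph_rank_contract[OF assms] card_Diff_subset[OF finite_subset[OF A fin] A] by auto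
  show "rank_of G A \<le> card A" using assms by (rule rank_of_le_card)
  show "card A \<le> card (edges G)" using A fin by (rule card_mono[rotated])
qed

text \<open>Rank and nullity are both additive over \<open>A\<close> and the contraction of
  \<open>A\<close>, so the product of the two monomials does not depend on \<open>A\<close>.\<close>

lemma power_rank_nullity_split:
  fixes x y :: "'k::comm_semiring_1"
  assumes G: "is_graph G" and A: "A \<subseteq> edges G"
  shows "x ^ rank_of G A * y ^ (card A - rank_of G A) *
      (x ^ (graph_rank G - rank_of G A) * y ^ (card (edges G) - card A - (graph_rank G - rank_of G A))) =
    x ^ graph_rank G * y ^ (card (edges G) - graph_rank G)"
proof -
  note b = rank_of_bounds[OF assms]
  have add: "x ^ i * y ^ j * (x ^ k * y ^ l) = x ^ (i + k) * y ^ (j + l)" for i j k l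
    by (simp add: power_add ac_simps)
  have "rank_of G A + (graph_rank G - rank_of G A) = graph_rank G"
    "card A - rank_of G A + (card (edges G) - card A - (graph_rank G - rank_of G A)) =
      card (edges G) - graph_rank G"
    using b by linarith+
  then show ?thesis by (simp only: add)
qed

text \<open>This is the value of the \<open>k\<close>-th convolution power of
  \<open>x \<delta>\<^sub>b + y \<delta>\<^sub>l\<close> at a class of rank \<open>r\<close> and
  size \<open>n\<close>; the factorial counts the orderings of the edges.\<close>

definition rank_size_form :: "'k::field_char_0 \<Rightarrow> 'k \<Rightarrow> nat \<Rightarrow> nat \<Rightarrow> nat \<Rightarrow> 'k" where
  "rank_size_form x y k r n = (if n = k then fact k * x ^ r * y ^ (n - r) else 0)"

lemma delta_single:
  "x * delta_b (Poly_Mapping.single c 1) + y * delta_l (Poly_Mapping.single c 1) =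
    rank_size_form x y 1 (class_rank c) (class_size c)"
proof -
  have "class_rank c \<le> 1" if "class_size c = 1"
    using class_rank_le_size[of c] that by simp
  then show ?thesis
    unfolding delta_b_def delta_l_def lookup_single when_def eq_class_bridge_iff eq_class_loop_iff
      rank_size_form_def
    by (cases "class_rank c = 0") (auto simp: le_Suc_eq)
qed

lemma conv_power_single:
  fixes x y :: "'k::field_char_0"
  shows "conv_power (\<lambda>h. x * delta_b h + y * delta_l h) k (Poly_Mapping.single c 1) =
    rank_size_form x y k (class_rank c) (class_size c)"
proof (induction k arbitrary: c)
  case 0
  show ?case
    \<comment> \<open>Size zero forces rank zero, so the monomial is 1 there.\<close>
    using class_rank_le_size[of c]
    by (auto simp: counit_def lookup_single when_def eq_class_point_iff rank_size_form_def)
next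
  case (Suc k)
  define R where "R = rep_gclass c"
  have R: "is_graph R" unfolding R_def by (rule is_graph_rep)
  note fin = is_graphD(2)[OF R]
  let ?r = "class_rank c" and ?n = "class_size c"
  have rn: "?r = graph_rank R" "?n = card (edges R)"
    by (simp_all add: R_def class_rank_def class_size_def)
  \<comment> \<open>\<open>?v\<close> is the contribution of each one-edge set, whichever edge it
    contains.\<close>
  let ?v = "if ?n = Suc k then fact k * (x ^ ?r * y ^ (?n - ?r)) else 0"
  have "conv_power (\<lambda>h. x * delta_b h + y * delta_l h) (Suc k) (Poly_Mapping.single c 1) =
      (\<Sum>A\<in>Pow (edges R). rank_size_form x y 1 (rank_of R A) (card A) *
        rank_size_form x y k (?r - rank_of R A) (?n - card A))"
    unfolding conv_power.simps R_def
    by (rule convolution_single[where F = "rank_size_form x y 1" and F' = "rank_size_form x y k"])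
      (rule delta_single Suc.IH)+
  also have "\<dots> = (\<Sum>A\<in>Pow (edges R). if card A = 1 then ?v else 0)"
  proof (intro sum.cong refl)
    fix A assume "A \<in> Pow (edges R)"
    then have A: "A \<subseteq> edges R" by simp
    have "card A \<le> ?n" using rank_of_bounds(4)[OF R A] rn by simp
    moreover have "x ^ ?r * y ^ (?n - ?r) = x ^ rank_of R A * y ^ (card A - rank_of R A) *
        (x ^ (?r - rank_of R A) * y ^ (?n - card A - (?r - rank_of R A)))"
      using power_rank_nullity_split[OF R A, of x y] unfolding rn by simp
    ultimately show "rank_size_form x y 1 (rank_of R A) (card A) *
        rank_size_form x y k (?r - rank_of R A) (?n - card A) = (if card A = 1 then ?v else 0)"
      by (auto simp: rank_size_form_def)
  qed
  also have "\<dots> = (\<Sum>A\<in>{A. A \<subseteq> edges R \<and> card A = 1}. ?v)"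
    using fin by (intro sum.mono_neutral_cong_right) auto
  also have "\<dots> = of_nat ?n * ?v"
    using n_subsets[OF fin, of 1] rn by simp
  \<comment> \<open>\<open>?v\<close> vanishes unless the size is \<open>Suc k\<close>; then the
    number of edges turns \<open>fact k\<close> into \<open>fact (Suc k)\<close>.\<close>
  also have "\<dots> = rank_size_form x y (Suc k) ?r ?n"
    by (simp add: rank_size_form_def)
  finally show ?case .
qed

text \<open>Only the power whose exponent is the size survives, and its factorial cancels.\<close>

lemma conv_exp_single:
  fixes x y :: "'k::field_char_0"
  shows "conv_exp (\<lambda>h. x * delta_b h + y * delta_l h) (Poly_Mapping.single c 1) =
    x ^ class_rank c * y ^ (class_size c - class_rank c)"
proof -
  let ?v = "x ^ class_rank c * y ^ (class_size c - class_rank c)"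
  have "conv_power (\<lambda>h. x * delta_b h + y * delta_l h) k (Poly_Mapping.single c 1) / fact k =
      (if k = class_size c then ?v else 0)" for k
    unfolding conv_power_single rank_size_form_def by auto
  then show ?thesis
    unfolding conv_exp_def by (simp only: Sum_any.delta)
qed

theorem theorem3p8:
  fixes G :: "('v, 'e) mgraph" and x1 x2 y1 y2 :: "'k::field_char_0"
  assumes "is_graph G" and "x1 \<noteq> 0" and "y2 \<noteq> 0"
  shows "alpha x1 x2 y1 y2 (basis G) =
    x1 ^ graph_rank G * y2 ^ (card (edges G) - graph_rank G) *
    tutte G (y1 / x1 + 1) (x2 / y2 + 1)"
proof -
  let ?r = "graph_rank G" and ?n = "card (edges G)"
  \<comment> \<open>The summand is a function of rank and cardinality of the subset alone, with
    \<open>?r\<close> and \<open>?n\<close> fixed, as \<open>rank_equiv_sum\<close>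
    requires.\<close>
  define F :: "nat \<Rightarrow> nat \<Rightarrow> 'k" where
    "F s m = x1 ^ s * x2 ^ (m - s) * (y1 ^ (?r - s) * y2 ^ (?n - m - (?r - s)))" for s m
  have "alpha x1 x2 y1 y2 (basis G) = (\<Sum>A\<in>Pow (edges (rep_gclass (class_of G))).
      F (rank_of (rep_gclass (class_of G)) A) (card A))"
    unfolding alpha_def basis_def F_def using assms(1)
    by (subst convolution_single[where F = "\<lambda>s m. x1 ^ s * x2 ^ (m - s)"
          and F' = "\<lambda>s m. y1 ^ s * y2 ^ (m - s)"]) (simp_all add: conv_exp_single)
  also have "\<dots> = (\<Sum>A\<in>Pow (edges G). F (rank_of G A) (card A))"
    by (rule rank_equiv_sum[OF rank_equiv_rep_class[OF assms(1)]])
  also have "\<dots> = (\<Sum>A\<in>Pow (edges G). x1 ^ ?r * y2 ^ (?n - ?r) *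
      ((y1 / x1) ^ (?r - rank_of G A) * (x2 / y2) ^ (card A - rank_of G A)))"
  proof (intro sum.cong refl)
    fix A assume "A \<in> Pow (edges G)"
    then have A: "A \<subseteq> edges G" by simp
    show "F (rank_of G A) (card A) = x1 ^ ?r * y2 ^ (?n - ?r) *
        ((y1 / x1) ^ (?r - rank_of G A) * (x2 / y2) ^ (card A - rank_of G A))"
      \<comment> \<open>The prefactor is split along \<open>A\<close>. Its power of
        \<open>x1\<close> from the contraction and its power of \<open>y2\<close> from
        \<open>A\<close> then cancel the denominators, which are nonzero.\<close>
      unfolding power_rank_nullity_split[OF assms(1) A, symmetric] F_def power_divide
      using assms(2,3) by simp
  qed
  also have "\<dots> = x1 ^ ?r * y2 ^ (?n - ?r) * tutte G (y1 / x1 + 1) (x2 / y2 + 1)"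
    by (simp add: tutte_def sum_distrib_left)
  finally show ?thesis .
qed

end
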